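(* For every tournament $T=(V,E)$ on $n$ vertices, $$c(T,5) \ge \frac{3}{4}\binom{n}{5} - \frac{1}{2}\binom{n-2}{2}\sum_{w\in V}\left(od(w)-\frac{n-1}{2}\right)^2 - \frac{3}{8}\binom{n}{3},$$ where $c(T,5)$ is the number of directed 5-cycles in $T$ and $od(w)$ is the out-degree of the vertex $w$ in $T$.
   Context: A tournament on $n$ vertices (an $n$-tournament) is a directed graph $T=(V,E)$ with $|V|=n$, without loops, such that for every pair of distinct vertices $u,v$ exactly one of $(u,v),(v,u)$ lies in $E$. The quantity $c(T,k)$ is the number of directed $k$-cycles of $T$, counted as subgraphs (i.e. cyclic rotations of the same vertex sequence give the same cycle). The out-degree is $od(w)=|\{x\in V : (w,x)\in E\}|$. *)

theory Defs
  imports Complex_Main "Graph_Theory.Pair_Digraph"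
begin

text \<open>A loop-free digraph without parallel arcs is here a \<open>pair_digraph\<close>, with finite vertex set
  \<open>pverts T\<close> and arc set \<open>parcs T\<close> consisting of ordered pairs of vertices.\<close>

locale tournament = pair_digraph T for T :: "'a pair_pre_digraph" +
  assumes exactly_one_arc:
    "\<lbrakk>u \<in> pverts T; v \<in> pverts T; u \<noteq> v\<rbrakk> \<Longrightarrow> (u, v) \<in> parcs T \<longleftrightarrow> (v, u) \<notin> parcs T"

text \<open>The library predicate \<open>cycle\<close> is about closed arc walks with distinguished starting point.
  The cycle as a subgraph is given by its set of arcs: two such walks have the same arc set iff
  they are cyclic rotations of each other.\<close>

definition dcycles :: "'a pair_pre_digraph \<Rightarrow> nat \<Rightarrow> ('a \<times> 'a) set set" where
  "dcycles T k = {set p | p. pre_digraph.cycle (with_proj T) p \<and> length p = k}"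

definition num_dcycles :: "'a pair_pre_digraph \<Rightarrow> nat \<Rightarrow> nat" where
  "num_dcycles T k = card (dcycles T k)"

lemma (in tournament) out_degree_eq:
  "out_degree (with_proj T) w = card {x \<in> pverts T. (w, x) \<in> parcs T}"
proof -
  have "out_arcs (with_proj T) w = Pair w ` {x \<in> pverts T. (w, x) \<in> parcs T}"
    using in_arcsD2 by (auto simp: out_arcs_def)
  then show ?thesis
    by (simp add: out_degree_def card_image inj_on_def)
qed

end

theory Submission
  imports Defs
begin

text \<open>Let \<open>s u v = 1\<close> if \<open>(u, v)\<close> is an arc and \<open>- 1\<close> if \<open>(v, u)\<close> is one, so that a 5-tuple of distinct
  vertices runs around a directed cycle with indicator \<open>\<Prod>(1 + s) / 2\<close> over its five consecutive
  pairs. Expanding and summing over all such tuples, the terms of odd degree cancel under reversal,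
  those of degree 2 reduce to the scores, and those of degree 4 are sums over paths
  \<open>s a b * s b c * s c d * s d e\<close>. Eliminating the end points \<open>e\<close> and \<open>a\<close> of the path leaves the
  nonnegative term \<open>\<Sum>c. (\<Sum>d. s c d * score d)\<^sup>2\<close>, a multiple of \<open>\<Sum>v. (score v)\<^sup>2\<close>, and a sum over
  closed 4-walks, for which the trivial bound suffices.\<close>

text \<open>Reindexing by the sign-reversing involution \<open>h\<close> shows that the sum equals
  its own negative.\<close>

lemma sum_antisymmetric_zero:
  fixes f :: "'a \<Rightarrow> real"
  assumes "\<And>t. t \<in> A \<Longrightarrow> h t \<in> A \<and> h (h t) = t \<and> f (h t) = - f t"
  shows "sum f A = 0"
proof -
  have "sum f A = (\<Sum>t\<in>A. - f t)"
    by (rule sum.reindex_bij_witness[of _ h h]) (use assms in auto)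
  then show ?thesis
    by (simp add: sum_negf)
qed

section \<open>Skew-symmetric sign matrices and sums over tuples of distinct vertices\<close>

locale skew_signs =
  fixes V :: "'a set" and s :: "'a \<Rightarrow> 'a \<Rightarrow> real"
  assumes finite_V: "finite V"
    and s_refl [simp]: "s a a = 0"
    and s_skew: "\<lbrakk>a \<in> V; b \<in> V\<rbrakk> \<Longrightarrow> s b a = - s a b"
    and s_square: "\<lbrakk>a \<in> V; b \<in> V; a \<noteq> b\<rbrakk> \<Longrightarrow> s a b * s a b = 1"
begin

definition D2 :: "('a \<times> 'a) set" where
  "D2 = {(a, b). {a, b} \<subseteq> V \<and> distinct [a, b]}"

definition D3 :: "('a \<times> 'a \<times> 'a) set" where
  "D3 = {(a, b, c). {a, b, c} \<subseteq> V \<and> distinct [a, b, c]}"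

definition D4 :: "('a \<times> 'a \<times> 'a \<times> 'a) set" where
  "D4 = {(a, b, c, d). {a, b, c, d} \<subseteq> V \<and> distinct [a, b, c, d]}"

definition D5 :: "('a \<times> 'a \<times> 'a \<times> 'a \<times> 'a) set" where
  "D5 = {(a, b, c, d, e). {a, b, c, d, e} \<subseteq> V \<and> distinct [a, b, c, d, e]}"

definition score :: "'a \<Rightarrow> real" where
  "score a = (\<Sum>b\<in>V. s a b)"

abbreviation n :: real where "n \<equiv> real (card V)"

abbreviation score_sq :: real where "score_sq \<equiv> \<Sum>v\<in>V. (score v)\<^sup>2"

lemma finite_D: "finite D2" "finite D3" "finite D4" "finite D5"
proof -
  show "finite D2"
    by (rule finite_subset[of _ "V \<times> V"]) (auto simp: D2_def finite_V)
  show "finite D3"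
    by (rule finite_subset[of _ "V \<times> V \<times> V"]) (auto simp: D3_def finite_V)
  show "finite D4"
    by (rule finite_subset[of _ "V \<times> V \<times> V \<times> V"]) (auto simp: D4_def finite_V)
  show "finite D5"
    by (rule finite_subset[of _ "V \<times> V \<times> V \<times> V \<times> V"]) (auto simp: D5_def finite_V)
qed

lemma sum_D2: "(\<Sum>(a,b)\<in>D2. f a b) = (\<Sum>a\<in>V. \<Sum>b\<in>V - {a}. f a b)" for f :: "_ \<Rightarrow> _ \<Rightarrow> real"
proof -
  have "D2 = Sigma V (\<lambda>a. V - {a})"
    by (auto simp: D2_def)
  then show ?thesis
    by (simp add: sum.Sigma finite_V)
qed

text \<open>The last coordinate is split off so that it can be summed out with the others fixed;
  this is how the end point of a path is eliminated.\<close>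

lemma sum_D3: "(\<Sum>(a,b,c)\<in>D3. f a b c) = (\<Sum>(a,b)\<in>D2. \<Sum>c\<in>V - {a,b}. f a b c)"
  for f :: "_ \<Rightarrow> _ \<Rightarrow> _ \<Rightarrow> real"
proof -
  have "(\<Sum>(a,b)\<in>D2. \<Sum>c\<in>V - {a,b}. f a b c)
      = (\<Sum>((a,b),c)\<in>Sigma D2 (\<lambda>(a,b). V - {a,b}). f a b c)"
    by (subst sum.Sigma[symmetric]) (auto simp: finite_D finite_V intro!: sum.cong)
  also have "\<dots> = (\<Sum>(a,b,c)\<in>D3. f a b c)"
    by (rule sum.reindex_bij_witness[of _ "\<lambda>(a,b,c). ((a,b),c)" "\<lambda>((a,b),c). (a,b,c)"])
      (auto simp: D2_def D3_def)
  finally show ?thesis ..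
qed

lemma sum_D4: "(\<Sum>(a,b,c,d)\<in>D4. f a b c d) = (\<Sum>(a,b,c)\<in>D3. \<Sum>d\<in>V - {a,b,c}. f a b c d)"
  for f :: "_ \<Rightarrow> _ \<Rightarrow> _ \<Rightarrow> _ \<Rightarrow> real"
proof -
  have "(\<Sum>(a,b,c)\<in>D3. \<Sum>d\<in>V - {a,b,c}. f a b c d)
      = (\<Sum>((a,b,c),d)\<in>Sigma D3 (\<lambda>(a,b,c). V - {a,b,c}). f a b c d)"
    by (subst sum.Sigma[symmetric]) (auto simp: finite_D finite_V intro!: sum.cong)
  also have "\<dots> = (\<Sum>(a,b,c,d)\<in>D4. f a b c d)"
    by (rule sum.reindex_bij_witness[of _ "\<lambda>(a,b,c,d). ((a,b,c),d)" "\<lambda>((a,b,c),d). (a,b,c,d)"])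
      (auto simp: D3_def D4_def)
  finally show ?thesis ..
qed

lemma sum_D5: "(\<Sum>(a,b,c,d,e)\<in>D5. f a b c d e)
    = (\<Sum>(a,b,c,d)\<in>D4. \<Sum>e\<in>V - {a,b,c,d}. f a b c d e)"
  for f :: "_ \<Rightarrow> _ \<Rightarrow> _ \<Rightarrow> _ \<Rightarrow> _ \<Rightarrow> real"
proof -
  have "(\<Sum>(a,b,c,d)\<in>D4. \<Sum>e\<in>V - {a,b,c,d}. f a b c d e)
      = (\<Sum>((a,b,c,d),e)\<in>Sigma D4 (\<lambda>(a,b,c,d). V - {a,b,c,d}). f a b c d e)"
    by (subst sum.Sigma[symmetric]) (auto simp: finite_D finite_V intro!: sum.cong)
  also have "\<dots> = (\<Sum>(a,b,c,d,e)\<in>D5. f a b c d e)"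
    by (rule sum.reindex_bij_witness[of _ "\<lambda>(a,b,c,d,e). ((a,b,c,d),e)"
          "\<lambda>((a,b,c,d),e). (a,b,c,d,e)"])
      (auto simp: D4_def D5_def)
  finally show ?thesis ..
qed

text \<open>A distinct list of excluded vertices makes the correction an explicit sum of terms once
  the list is a literal, so one statement serves every number of exclusions.\<close>

lemma sum_V_minus:
  fixes f :: "_ \<Rightarrow> real"
  assumes "set xs \<subseteq> V" "distinct xs"
  shows "(\<Sum>v\<in>V - set xs. f v) = (\<Sum>v\<in>V. f v) - (\<Sum>v\<leftarrow>xs. f v)"
  using assms by (simp add: sum_diff finite_V sum_list_distinct_conv_sum_set)

lemma card_V_minus:
  assumes "set xs \<subseteq> V" "distinct xs"
  shows "real (card (V - set xs)) = n - real (length xs)"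
  using sum_V_minus[OF assms, of "\<lambda>_. 1"] by (simp add: sum_list_triv)

lemmas tail_sums =
  sum_V_minus[of "[_, _]", simplified] sum_V_minus[of "[_, _, _]", simplified]
  sum_V_minus[of "[_, _, _, _]", simplified]

lemmas tail_cards =
  card_V_minus[of "[_]", simplified] card_V_minus[of "[_, _]", simplified]
  card_V_minus[of "[_, _, _]", simplified] card_V_minus[of "[_, _, _, _]", simplified]

section \<open>Score sums, tuple counts and the terms of degree 2\<close>

lemma score_column: "b \<in> V \<Longrightarrow> (\<Sum>a\<in>V. s a b) = - score b"
  unfolding score_def by (subst sum_negf[symmetric]) (auto intro!: sum.cong s_skew)

text \<open>The diagonal can be added at no cost because \<open>s a a = 0\<close>; after swapping
  the sums, the inner one is a column sum.\<close>

lemma sum_D2_s_score: "(\<Sum>(a,b)\<in>D2. s a b * score b) = - score_sq"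
proof -
  have "(\<Sum>(a,b)\<in>D2. s a b * score b) = (\<Sum>a\<in>V. \<Sum>b\<in>V. s a b * score b)"
    unfolding sum_D2 by (rule sum.cong) (auto simp: sum_diff1 finite_V)
  also have "\<dots> = (\<Sum>b\<in>V. (\<Sum>a\<in>V. s a b) * score b)"
    by (subst sum.swap) (simp add: sum_distrib_right)
  also have "\<dots> = - score_sq"
    by (simp add: score_column power2_eq_square sum_negf)
  finally show ?thesis .
qed

lemma card_D2: "real (card D2) = n * (n - 1)"
  using sum_D2[of "\<lambda>_ _. 1"] by (simp add: tail_cards del: card_Diff_insert)

lemma card_D3: "real (card D3) = n * (n - 1) * (n - 2)"
proof -
  have "real (card D3) = (\<Sum>(a,b,c)\<in>D3. 1)"
    by simp
  also have "\<dots> = (\<Sum>(a,b)\<in>D2. n - 2)"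
    unfolding sum_D3 by (rule sum.cong) (auto simp: D2_def tail_cards simp del: card_Diff_insert)
  finally show ?thesis
    by (simp add: card_D2)
qed

lemma card_D4: "real (card D4) = n * (n - 1) * (n - 2) * (n - 3)"
proof -
  have "real (card D4) = (\<Sum>(a,b,c,d)\<in>D4. 1)"
    by simp
  also have "\<dots> = (\<Sum>(a,b,c)\<in>D3. n - 3)"
    unfolding sum_D4 by (rule sum.cong) (auto simp: D3_def tail_cards simp del: card_Diff_insert)
  finally show ?thesis
    by (simp add: card_D3)
qed

lemma card_D5: "real (card D5) = n * (n - 1) * (n - 2) * (n - 3) * (n - 4)"
proof -
  have "real (card D5) = (\<Sum>(a,b,c,d,e)\<in>D5. 1)"
    by simp
  also have "\<dots> = (\<Sum>(a,b,c,d)\<in>D4. n - 4)"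
    unfolding sum_D5 by (rule sum.cong) (auto simp: D4_def tail_cards simp del: card_Diff_insert)
  finally show ?thesis
    by (simp add: card_D4)
qed

text \<open>Summing out \<open>c\<close> leaves \<open>score b - s b a\<close>. The excluded vertex
  \<open>a\<close> thus contributes \<open>- s a b * s b a = 1\<close> for each of the
  \<open>n * (n - 1)\<close> pairs.\<close>

lemma sum_2_path: "(\<Sum>(a,b,c)\<in>D3. s a b * s b c) = n * (n - 1) - score_sq"
proof -
  have "(\<Sum>(a,b,c)\<in>D3. s a b * s b c) = (\<Sum>(a,b)\<in>D2. s a b * score b + 1)"
    unfolding sum_D3
  proof (rule sum.cong[OF refl], clarify)
    fix a b assume "(a, b) \<in> D2"
    then have "a \<in> V" "b \<in> V" "a \<noteq> b"
      by (auto simp: D2_def)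
    then show "(\<Sum>c\<in>V - {a,b}. s a b * s b c) = s a b * score b + 1"
      using s_square[of a b] s_skew[of a b]
      by (simp add: sum_distrib_left[symmetric] tail_sums score_def[symmetric] algebra_simps)
  qed
  also have "\<dots> = n * (n - 1) - score_sq"
    using sum_D2_s_score by (simp add: case_prod_unfold sum.distrib card_D2)
  finally show ?thesis .
qed

lemma sum_2_path_D4: "(\<Sum>(a,b,c,d)\<in>D4. s a b * s b c) = (n - 3) * (n * (n - 1) - score_sq)"
proof -
  have "(\<Sum>(a,b,c,d)\<in>D4. s a b * s b c) = (\<Sum>(a,b,c)\<in>D3. (n - 3) * (s a b * s b c))"
    unfolding sum_D4 by (rule sum.cong) (auto simp: D3_def tail_cards simp del: card_Diff_insert)
  then show ?thesis
    by (simp add: sum_2_path[symmetric] sum_distrib_left case_prod_unfold)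
qed

lemma sum_2_path_D5:
  "(\<Sum>(a,b,c,d,e)\<in>D5. s a b * s b c) = (n - 3) * (n - 4) * (n * (n - 1) - score_sq)"
proof -
  have "(\<Sum>(a,b,c,d,e)\<in>D5. s a b * s b c) = (\<Sum>(a,b,c,d)\<in>D4. (n - 4) * (s a b * s b c))"
    unfolding sum_D5 by (rule sum.cong) (auto simp: D4_def tail_cards simp del: card_Diff_insert)
  also have "\<dots> = (n - 4) * (\<Sum>(a,b,c,d)\<in>D4. s a b * s b c)"
    by (simp add: sum_distrib_left case_prod_unfold)
  finally show ?thesis
    by (simp add: sum_2_path_D4)
qed

text \<open>Exchanging \<open>c\<close> and \<open>d\<close> reverses one factor and leaves the
  other alone.\<close>

lemma sum_disjoint_pair: "(\<Sum>(a,b,c,d,e)\<in>D5. s a b * s c d) = 0"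
proof (rule sum_antisymmetric_zero[where h = "\<lambda>(a,b,c,d,e). (a,b,d,c,e)"])
  fix t assume "t \<in> D5"
  then obtain a b c d e where t: "t = (a,b,c,d,e)" "{a,b,c,d,e} \<subseteq> V" "distinct [a,b,c,d,e]"
    by (auto simp: D5_def)
  then have "s d c = - s c d"
    by (intro s_skew) auto
  with t show "(case t of (a,b,c,d,e) \<Rightarrow> (a,b,d,c,e)) \<in> D5
      \<and> (case case t of (a,b,c,d,e) \<Rightarrow> (a,b,d,c,e) of (a,b,c,d,e) \<Rightarrow> (a,b,d,c,e)) = t
      \<and> (case case t of (a,b,c,d,e) \<Rightarrow> (a,b,d,c,e) of (a,b,c,d,e) \<Rightarrow> s a b * s c d)
        = - (case t of (a,b,c,d,e) \<Rightarrow> s a b * s c d)"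
    by (auto simp: D5_def)
qed

section \<open>Sums over paths with four arcs\<close>

text \<open>Summing out \<open>d\<close> gives the full row sum at \<open>c\<close>, minus the term
  at the excluded vertex \<open>b\<close>, which turns into \<open>(score b)\<^sup>2\<close>.
  Summing the main part over \<open>b\<close> reproduces the same row sum with opposite sign, hence
  minus a square.\<close>

lemma sum_score_path:
  "(\<Sum>(b,c,d)\<in>D3. score b * s b c * s c d * score d)
    = (n - 1) * score_sq - (\<Sum>c\<in>V. (\<Sum>d\<in>V. s c d * score d)\<^sup>2)"
proof -
  have column: "(\<Sum>b\<in>V - {c}. score b * s b c * x) = - (\<Sum>b\<in>V. s c b * score b) * x"
    if "c \<in> V" for c x
  proof -
    have "(\<Sum>b\<in>V - {c}. score b * s b c * x) = (\<Sum>b\<in>V. - (s c b * score b * x))"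
      by (rule sum.mono_neutral_cong_left) (use finite_V s_skew[OF that] in auto)
    then show ?thesis
      by (simp add: sum_negf sum_distrib_right)
  qed
  have "(\<Sum>(b,c,d)\<in>D3. score b * s b c * s c d * score d)
      = (\<Sum>(b,c)\<in>D2. score b * s b c * (\<Sum>d\<in>V. s c d * score d) + (score b)\<^sup>2)"
    unfolding sum_D3
  proof (rule sum.cong[OF refl], clarify)
    fix b c assume "(b, c) \<in> D2"
    then have bc: "b \<in> V" "c \<in> V" "b \<noteq> c"
      by (auto simp: D2_def)
    have "(\<Sum>d\<in>V - {b,c}. score b * s b c * s c d * score d)
        = score b * s b c * (\<Sum>d\<in>V - {b,c}. s c d * score d)"
      by (simp add: sum_distrib_left mult.assoc)
    also have "\<dots> = score b * s b c * ((\<Sum>d\<in>V. s c d * score d) - s c b * score b)"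
      using bc by (simp add: tail_sums)
    also have "\<dots> = score b * s b c * (\<Sum>d\<in>V. s c d * score d) + (s b c * s b c) * (score b)\<^sup>2"
      using s_skew[of b c] bc by (simp add: algebra_simps power2_eq_square)
    finally show "(\<Sum>d\<in>V - {b,c}. score b * s b c * s c d * score d)
        = score b * s b c * (\<Sum>d\<in>V. s c d * score d) + (score b)\<^sup>2"
      using s_square[of b c] bc by simp
  qed
  also have "\<dots> = (\<Sum>(b,c)\<in>D2. score b * s b c * (\<Sum>d\<in>V. s c d * score d))
      + (\<Sum>(b,c)\<in>D2. (score b)\<^sup>2)"
    by (simp add: case_prod_unfold sum.distrib)
  also have "(\<Sum>(b,c)\<in>D2. (score b)\<^sup>2) = (n - 1) * score_sq"
    unfolding sum_D2 by (simp add: tail_cards sum_distrib_left del: card_Diff_insert)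
  \<comment> \<open>The middle vertex \<open>c\<close> is put first so that \<open>b\<close> becomes
    the inner variable and \<open>column\<close> applies.\<close>
  also have "(\<Sum>(b,c)\<in>D2. score b * s b c * (\<Sum>d\<in>V. s c d * score d))
      = (\<Sum>(c,b)\<in>D2. score b * s b c * (\<Sum>d\<in>V. s c d * score d))"
    by (rule sum.reindex_bij_witness[of _ "\<lambda>(a,b). (b,a)" "\<lambda>(a,b). (b,a)"])
      (auto simp: D2_def)
  also have "\<dots> = - (\<Sum>c\<in>V. (\<Sum>d\<in>V. s c d * score d)\<^sup>2)"
    unfolding sum_D2 by (simp add: column sum_negf power2_eq_square)
  finally show ?thesis
    by simp
qed

text \<open>Summing out the start \<open>a\<close> turns \<open>s a b\<close> into
  \<open>- score b\<close> corrected at \<open>c\<close> and \<open>d\<close>. The correction at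
  \<open>c\<close> meets \<open>s b c\<close> and gives \<open>s b c * s b c = 1\<close>; the one at
  \<open>d\<close> cancels in total.\<close>

lemma sum_3_path_score:
  "(\<Sum>(a,b,c,d)\<in>D4. s a b * s b c * s c d * score d)
    = (\<Sum>c\<in>V. (\<Sum>d\<in>V. s c d * score d)\<^sup>2) - (2 * n - 3) * score_sq"
proof -
  have "(\<Sum>(a,b,c,d)\<in>D4. s a b * s b c * s c d * score d)
      = (\<Sum>(b,c,d,a)\<in>D4. s a b * s b c * s c d * score d)"
    by (rule sum.reindex_bij_witness[of _ "\<lambda>(b,c,d,a). (a,b,c,d)" "\<lambda>(a,b,c,d). (b,c,d,a)"])
      (auto simp: D4_def)
  also have "\<dots> = (\<Sum>(b,c,d)\<in>D3. - (score b * s b c * s c d * score d)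
      + s c d * score d + s b d * s b c * s c d * score d)"
    unfolding sum_D4
  proof (rule sum.cong[OF refl], clarify)
    fix b c d assume "(b, c, d) \<in> D3"
    then have bcd: "b \<in> V" "c \<in> V" "d \<in> V" "b \<noteq> c" "b \<noteq> d" "c \<noteq> d"
      by (auto simp: D3_def)
    have "(\<Sum>a\<in>V - {b,c,d}. s a b * s b c * s c d * score d)
        = - (score b - s b c - s b d) * s b c * s c d * score d"
      using bcd s_skew[of b c] s_skew[of b d]
      by (simp add: sum_distrib_right[symmetric] tail_sums score_column)
    also have "\<dots> = - (score b * s b c * s c d * score d)
        + (s b c * s b c) * (s c d * score d) + s b d * s b c * s c d * score d"
      by (simp add: algebra_simps)
    finally show "(\<Sum>a\<in>V - {b,c,d}. s a b * s b c * s c d * score d)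
        = - (score b * s b c * s c d * score d)
        + s c d * score d + s b d * s b c * s c d * score d"
      using s_square[of b c] bcd by simp
  qed
  also have "\<dots> = - (\<Sum>(b,c,d)\<in>D3. score b * s b c * s c d * score d)
      + (\<Sum>(b,c,d)\<in>D3. s c d * score d) + (\<Sum>(b,c,d)\<in>D3. s b d * s b c * s c d * score d)"
    by (simp add: case_prod_unfold sum.distrib sum_subtractf)
  \<comment> \<open>Under the exchange of \<open>b\<close> and \<open>c\<close>, the factors
    \<open>s b d\<close> and \<open>s c d\<close> trade places while \<open>s b c\<close> changes
    sign.\<close>
  also have "(\<Sum>(b,c,d)\<in>D3. s b d * s b c * s c d * score d) = 0"
  proof (rule sum_antisymmetric_zero[where h = "\<lambda>(b,c,d). (c,b,d)"])
    fix t assume "t \<in> D3"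
    then obtain b c d where t: "t = (b,c,d)" "{b,c,d} \<subseteq> V" "distinct [b,c,d]"
      by (auto simp: D3_def)
    then have "s c b = - s b c"
      by (intro s_skew) auto
    with t show "(case t of (b,c,d) \<Rightarrow> (c,b,d)) \<in> D3
        \<and> (case case t of (b,c,d) \<Rightarrow> (c,b,d) of (b,c,d) \<Rightarrow> (c,b,d)) = t
        \<and> (case case t of (b,c,d) \<Rightarrow> (c,b,d) of (b,c,d) \<Rightarrow> s b d * s b c * s c d * score d)
          = - (case t of (b,c,d) \<Rightarrow> s b d * s b c * s c d * score d)"
      by (auto simp: D3_def)
  qed
  also have "(\<Sum>(b,c,d)\<in>D3. s c d * score d) = - (n - 2) * score_sq"
  proof -
    have "(\<Sum>(b,c,d)\<in>D3. s c d * score d) = (\<Sum>(c,d,b)\<in>D3. s c d * score d)"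
      by (rule sum.reindex_bij_witness[of _ "\<lambda>(c,d,b). (b,c,d)" "\<lambda>(b,c,d). (c,d,b)"])
        (auto simp: D3_def)
    also have "\<dots> = (\<Sum>(c,d)\<in>D2. (n - 2) * (s c d * score d))"
      unfolding sum_D3 by (rule sum.cong) (auto simp: D2_def tail_cards simp del: card_Diff_insert)
    also have "\<dots> = (n - 2) * (\<Sum>(c,d)\<in>D2. s c d * score d)"
      by (simp add: sum_distrib_left case_prod_unfold)
    finally show ?thesis
      by (simp add: sum_D2_s_score algebra_simps)
  qed
  finally show ?thesis
    unfolding sum_score_path by (simp add: algebra_simps)
qed

text \<open>Exchanging \<open>c\<close> and \<open>d\<close> reverses the triangle on
  \<open>b\<close>, \<open>c\<close>, \<open>d\<close>: three factors change sign and
  \<open>s a b\<close> stays.\<close>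

lemma sum_triangle_tail: "(\<Sum>(a,b,c,d)\<in>D4. s a b * s b c * s c d * s d b) = 0"
proof (rule sum_antisymmetric_zero[where h = "\<lambda>(a,b,c,d). (a,b,d,c)"])
  fix t assume "t \<in> D4"
  then obtain a b c d where t: "t = (a,b,c,d)" "{a,b,c,d} \<subseteq> V" "distinct [a,b,c,d]"
    by (auto simp: D4_def)
  then have "s d c = - s c d" "s b d = - s d b" "s c b = - s b c"
    by (auto intro!: s_skew)
  with t show "(case t of (a,b,c,d) \<Rightarrow> (a,b,d,c)) \<in> D4
      \<and> (case case t of (a,b,c,d) \<Rightarrow> (a,b,d,c) of (a,b,c,d) \<Rightarrow> (a,b,d,c)) = t
      \<and> (case case t of (a,b,c,d) \<Rightarrow> (a,b,d,c) of (a,b,c,d) \<Rightarrow> s a b * s b c * s c d * s d b)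
        = - (case t of (a,b,c,d) \<Rightarrow> s a b * s b c * s c d * s d b)"
    by (auto simp: D4_def)
qed

lemma sum_4_cycle_le:
  "(\<Sum>(a,b,c,d)\<in>D4. s a b * s b c * s c d * s d a) \<le> n * (n - 1) * (n - 2) * (n - 3)"
proof -
  have abs_s: "\<bar>s a b\<bar> = 1" if "a \<in> V" "b \<in> V" "a \<noteq> b" for a b
    using s_square[OF that] by (metis abs_square_eq_1 power2_eq_square)
  have "(\<Sum>(a,b,c,d)\<in>D4. s a b * s b c * s c d * s d a) \<le> (\<Sum>(a,b,c,d)\<in>D4. 1)"
  proof (rule sum_mono, clarify)
    fix a b c d assume "(a, b, c, d) \<in> D4"
    then have "\<bar>s a b * s b c * s c d * s d a\<bar> = 1"
      by (auto simp: D4_def abs_mult abs_s)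
    then show "s a b * s b c * s c d * s d a \<le> 1"
      by linarith
  qed
  then show ?thesis
    by (simp add: card_D4)
qed

text \<open>Summing out \<open>e\<close> replaces \<open>s d e\<close> by
  \<open>score d - s d a - s d b - s d c\<close>. The corrections close a 4-cycle, close a triangle
  with a tail, and fold back onto \<open>s c d\<close>, leaving a 2-path.\<close>

lemma sum_4_path_ge:
  "(\<Sum>(a,b,c,d,e)\<in>D5. s a b * s b c * s c d * s d e)
    \<ge> n * (n - 1) * (n - 3) - (3 * n - 6) * score_sq - n * (n - 1) * (n - 2) * (n - 3)"
proof -
  have "(\<Sum>(a,b,c,d,e)\<in>D5. s a b * s b c * s c d * s d e)
      = (\<Sum>(a,b,c,d)\<in>D4. s a b * s b c * s c d * score d - s a b * s b c * s c d * s d a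
          - s a b * s b c * s c d * s d b + s a b * s b c)"
    unfolding sum_D5
  proof (rule sum.cong[OF refl], clarify)
    fix a b c d assume "(a, b, c, d) \<in> D4"
    then have abcd: "{a, b, c, d} \<subseteq> V" "distinct [a, b, c, d]"
      by (auto simp: D4_def)
    have "(\<Sum>e\<in>V - {a,b,c,d}. s a b * s b c * s c d * s d e)
        = s a b * s b c * s c d * (score d - s d a - s d b - s d c)"
      using abcd by (simp add: sum_distrib_left[symmetric] tail_sums score_def)
    also have "s d c = - s c d"
      using abcd by (auto intro: s_skew)
    also have "s a b * s b c * s c d * (score d - s d a - s d b - - s c d)
        = s a b * s b c * s c d * score d - s a b * s b c * s c d * s d a
          - s a b * s b c * s c d * s d b + s a b * s b c * (s c d * s c d)"
      by (simp add: algebra_simps)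
    finally show "(\<Sum>e\<in>V - {a,b,c,d}. s a b * s b c * s c d * s d e)
        = s a b * s b c * s c d * score d - s a b * s b c * s c d * s d a
          - s a b * s b c * s c d * s d b + s a b * s b c"
      using s_square[of c d] abcd by simp
  qed
  also have "\<dots> = (\<Sum>(a,b,c,d)\<in>D4. s a b * s b c * s c d * score d)
      - (\<Sum>(a,b,c,d)\<in>D4. s a b * s b c * s c d * s d a)
      - (\<Sum>(a,b,c,d)\<in>D4. s a b * s b c * s c d * s d b)
      + (\<Sum>(a,b,c,d)\<in>D4. s a b * s b c)"
    by (simp add: case_prod_unfold sum.distrib sum_subtractf)
  also have "\<dots> = (\<Sum>c\<in>V. (\<Sum>d\<in>V. s c d * score d)\<^sup>2) - (2 * n - 3) * score_sq
      - (\<Sum>(a,b,c,d)\<in>D4. s a b * s b c * s c d * s d a) + (n - 3) * (n * (n - 1) - score_sq)"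
    by (simp only: sum_3_path_score sum_triangle_tail sum_2_path_D4 diff_0_right)
  finally have "(\<Sum>(a,b,c,d,e)\<in>D5. s a b * s b c * s c d * s d e)
      = (\<Sum>c\<in>V. (\<Sum>d\<in>V. s c d * score d)\<^sup>2) - (2 * n - 3) * score_sq
      - (\<Sum>(a,b,c,d)\<in>D4. s a b * s b c * s c d * s d a) + (n - 3) * (n * (n - 1) - score_sq)" .
  \<comment> \<open>Up to here everything is an identity; dropping these squares and bounding the
    4-cycle sum are the only losses.\<close>
  moreover have "(\<Sum>c\<in>V. (\<Sum>d\<in>V. s c d * score d)\<^sup>2) \<ge> 0"
    by (simp add: sum_nonneg)
  moreover have "(n - 3) * (n * (n - 1) - score_sq) - (2 * n - 3) * score_sq
      = n * (n - 1) * (n - 3) - (3 * n - 6) * score_sq"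
    by (simp add: algebra_simps)
  ultimately show ?thesis
    using sum_4_cycle_le by linarith
qed

section \<open>Expansion of the 5-cycle indicator\<close>

lemma sum_D5_rotate: "(\<Sum>(a,b,c,d,e)\<in>D5. f b c d e a) = (\<Sum>(a,b,c,d,e)\<in>D5. f a b c d e)"
  for f :: "_ \<Rightarrow> _ \<Rightarrow> _ \<Rightarrow> _ \<Rightarrow> _ \<Rightarrow> real"
  by (rule sum.reindex_bij_witness[of _ "\<lambda>(b,c,d,e,a). (a,b,c,d,e)" "\<lambda>(a,b,c,d,e). (b,c,d,e,a)"])
    (auto simp: D5_def)

text \<open>The ten pairs of arcs of a 5-cycle are five adjacent and five disjoint ones, the latter
  summing to 0; omitting one arc leaves one of five 4-arc paths.\<close>

lemma sum_5_cycle_indicator: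
  "(\<Sum>(a,b,c,d,e)\<in>D5. (1 + s a b) * (1 + s b c) * (1 + s c d) * (1 + s d e) * (1 + s e a))
    = n * (n - 1) * (n - 2) * (n - 3) * (n - 4)
      + 5 * ((n - 3) * (n - 4) * (n * (n - 1) - score_sq))
      + 5 * (\<Sum>(a,b,c,d,e)\<in>D5. s a b * s b c * s c d * s d e)"
    (is "(\<Sum>(a,b,c,d,e)\<in>D5. ?p a b c d e) = ?rhs")
proof -
  \<comment> \<open>Reversing the tuple turns \<open>?p\<close> into \<open>q\<close>, and
    \<open>?p + q\<close> retains only the terms of even degree.\<close>
  define q where "q a b c d e = (1 - s a b) * (1 - s b c) * (1 - s c d) * (1 - s d e) * (1 - s e a)"
    for a b c d e
  \<comment> \<open>One representative of each rotation class of nonconstant even terms; its five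
    rotations give them all.\<close>
  define g where "g a b c d e = s a b * s b c + s a b * s c d + s a b * s b c * s c d * s d e"
    for a b c d e
  have "(\<Sum>(a,b,c,d,e)\<in>D5. ?p a b c d e) = (\<Sum>(e,d,c,b,a)\<in>D5. ?p a b c d e)"
    by (rule sum.reindex_bij_witness[of _ "\<lambda>(a,b,c,d,e). (e,d,c,b,a)" "\<lambda>(a,b,c,d,e). (e,d,c,b,a)"])
      (auto simp: D5_def)
  also have "\<dots> = (\<Sum>(e,d,c,b,a)\<in>D5. q e d c b a)"
  proof (rule sum.cong[OF refl], clarify)
    fix a b c d e assume "(e, d, c, b, a) \<in> D5"
    then have "s a b = - s b a" "s b c = - s c b" "s c d = - s d c" "s d e = - s e d" "s e a = - s a e"
      by (auto simp: D5_def intro!: s_skew)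
    then show "?p a b c d e = q e d c b a"
      by (simp add: q_def)
  qed
  finally have "(\<Sum>(a,b,c,d,e)\<in>D5. ?p a b c d e) = (\<Sum>(a,b,c,d,e)\<in>D5. q a b c d e)" .
  then have "2 * (\<Sum>(a,b,c,d,e)\<in>D5. ?p a b c d e)
      = (\<Sum>(a,b,c,d,e)\<in>D5. ?p a b c d e + q a b c d e)"
    by (simp add: case_prod_unfold sum.distrib)
  also have "\<dots> = (\<Sum>(a,b,c,d,e)\<in>D5. 2 * (1 + g a b c d e + g b c d e a + g c d e a b
      + g d e a b c + g e a b c d))"
  proof (rule sum.cong[OF refl], clarify)
    fix a b c d e
    have "(1 + p) * (1 + q) * (1 + r) * (1 + t) * (1 + u)
        + (1 - p) * (1 - q) * (1 - r) * (1 - t) * (1 - u)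
      = 2 * (1 + (p * q + p * r + p * q * r * t) + (q * r + q * t + q * r * t * u)
        + (r * t + r * u + r * t * u * p) + (t * u + t * p + t * u * p * q)
        + (u * p + u * q + u * p * q * r))" for p q r t u :: real
      by algebra
    then show "?p a b c d e + q a b c d e
        = 2 * (1 + g a b c d e + g b c d e a + g c d e a b + g d e a b c + g e a b c d)"
      unfolding q_def g_def .
  qed
  also have "\<dots> = 2 * (real (card D5) + (\<Sum>(a,b,c,d,e)\<in>D5. g a b c d e)
      + (\<Sum>(a,b,c,d,e)\<in>D5. g b c d e a) + (\<Sum>(a,b,c,d,e)\<in>D5. g c d e a b)
      + (\<Sum>(a,b,c,d,e)\<in>D5. g d e a b c) + (\<Sum>(a,b,c,d,e)\<in>D5. g e a b c d))"
    unfolding case_prod_unfold sum_distrib_left[symmetric] sum.distrib by simp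
  also have "\<dots> = 2 * (real (card D5) + 5 * (\<Sum>(a,b,c,d,e)\<in>D5. g a b c d e))"
    using sum_D5_rotate[of g] sum_D5_rotate[of "\<lambda>a b c d e. g b c d e a"]
      sum_D5_rotate[of "\<lambda>a b c d e. g c d e a b"] sum_D5_rotate[of "\<lambda>a b c d e. g d e a b c"]
    by simp
  also have "(\<Sum>(a,b,c,d,e)\<in>D5. g a b c d e)
      = (n - 3) * (n - 4) * (n * (n - 1) - score_sq) + 0
        + (\<Sum>(a,b,c,d,e)\<in>D5. s a b * s b c * s c d * s d e)"
    unfolding sum_2_path_D5[symmetric] sum_disjoint_pair[symmetric] g_def
    by (simp add: case_prod_unfold sum.distrib)
  finally show ?thesis
    by (simp add: card_D5)
qed

end

section \<open>The sign matrix of a tournament and its scores\<close>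

context tournament
begin

definition arc_sign :: "'a \<Rightarrow> 'a \<Rightarrow> real" where
  "arc_sign u v = (if u = v then 0 else if (u, v) \<in> parcs T then 1 else - 1)"

sublocale signs: skew_signs "pverts T" arc_sign
proof unfold_locales
  fix a b assume "a \<in> pverts T" "b \<in> pverts T"
  then show "arc_sign b a = - arc_sign a b"
    using exactly_one_arc[of a b] by (cases "a = b") (auto simp: arc_sign_def)
qed (auto simp: arc_sign_def)

lemma score_eq:
  assumes w: "w \<in> pverts T"
  shows "signs.score w = 2 * real (out_degree (with_proj T) w) - (real (card (pverts T)) - 1)"
proof -
  let ?O = "{x \<in> pverts T. (w, x) \<in> parcs T}"
  have "w \<notin> ?O"
    using no_loops' by blast
  \<comment> \<open>The last summand corrects the diagonal, where the sign is 0 instead of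
    -1.\<close>
  have "signs.score w = (\<Sum>x\<in>pverts T. 2 * of_bool ((w, x) \<in> parcs T) - 1 + of_bool (x = w))"
    unfolding signs.score_def using \<open>w \<notin> ?O\<close> w
    by (intro sum.cong) (auto simp: arc_sign_def)
  also have "\<dots> = 2 * real (card ?O) - real (card (pverts T)) + 1"
    using w by (simp add: sum.distrib sum_subtractf sum_distrib_left[symmetric] of_bool_def
        sum.If_cases Int_def)
  finally show ?thesis
    by (simp add: out_degree_eq)
qed

section \<open>Directed 5-cycles counted through vertex tuples\<close>

definition cycle5_tuples :: "('a \<times> 'a \<times> 'a \<times> 'a \<times> 'a) set" where
  "cycle5_tuples = {(a,b,c,d,e) \<in> signs.D5. {(a,b), (b,c), (c,d), (d,e), (e,a)} \<subseteq> parcs T}"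

text \<open>Each factor is 2 on an arc and 0 on a reversed arc, so the product is
  \<open>2^5 = 32\<close> on cycle tuples and 0 on all others.\<close>

lemma card_cycle5_tuples:
  "32 * real (card cycle5_tuples) = (\<Sum>(a,b,c,d,e)\<in>signs.D5. (1 + arc_sign a b)
     * (1 + arc_sign b c) * (1 + arc_sign c d) * (1 + arc_sign d e) * (1 + arc_sign e a))"
proof -
  have "(\<Sum>(a,b,c,d,e)\<in>signs.D5. (1 + arc_sign a b)
     * (1 + arc_sign b c) * (1 + arc_sign c d) * (1 + arc_sign d e) * (1 + arc_sign e a))
    = (\<Sum>t\<in>signs.D5. if t \<in> cycle5_tuples then 32 else 0)"
    by (rule sum.cong) (auto simp: cycle5_tuples_def signs.D5_def arc_sign_def split: if_splits)
  also have "\<dots> = (\<Sum>t\<in>signs.D5 \<inter> cycle5_tuples. 32)"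
    by (simp add: sum.If_cases signs.finite_D)
  also have "signs.D5 \<inter> cycle5_tuples = cycle5_tuples"
    by (auto simp: cycle5_tuples_def)
  finally show ?thesis
    by simp
qed

definition arcs5 :: "'a \<times> 'a \<times> 'a \<times> 'a \<times> 'a \<Rightarrow> ('a \<times> 'a) set" where
  "arcs5 = (\<lambda>(a,b,c,d,e). {(a,b), (b,c), (c,d), (d,e), (e,a)})"

lemma arcs5_dcycle:
  assumes "t \<in> cycle5_tuples"
  shows "arcs5 t \<in> dcycles T 5"
proof -
  obtain a b c d e where t: "t = (a, b, c, d, e)"
    by (cases t) auto
  let ?p = "[(a,b), (b,c), (c,d), (d,e), (e,a)]"
  have "pre_digraph.cycle (with_proj T) ?p"
    using assms unfolding t
    by (auto simp: cycle5_tuples_def signs.D5_def pre_digraph.cycle_def pre_digraph.awalk_def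
        pre_digraph.awalk_verts.simps pre_digraph.cas.simps)
  then show ?thesis
    unfolding dcycles_def t arcs5_def by (intro CollectI exI[of _ ?p]) simp
qed

text \<open>The arc set fixes the successor of each of its five vertices, so a tuple is determined
  by its first vertex.\<close>

lemma card_arcs5_fibre_le: "card {t \<in> cycle5_tuples. arcs5 t = C} \<le> 5"
proof (cases "{t \<in> cycle5_tuples. arcs5 t = C} = {}")
  case False
  then obtain a b c d e where t: "(a,b,c,d,e) \<in> cycle5_tuples" "C = arcs5 (a,b,c,d,e)"
    by auto
  have dist: "distinct [a,b,c,d,e]"
    using t(1) by (auto simp: cycle5_tuples_def signs.D5_def)
  let ?R = "[(a,b,c,d,e), (b,c,d,e,a), (c,d,e,a,b), (d,e,a,b,c), (e,a,b,c,d)]"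
  have "{t \<in> cycle5_tuples. arcs5 t = C} \<subseteq> set ?R"
  proof clarify
    fix a' b' c' d' e' assume "C = arcs5 (a',b',c',d',e')"
    then have *: "(a',b') \<in> C" "(b',c') \<in> C" "(c',d') \<in> C" "(d',e') \<in> C"
      by (auto simp: arcs5_def)
    have succs: "\<And>y. (a,y) \<in> C \<Longrightarrow> y = b" "\<And>y. (b,y) \<in> C \<Longrightarrow> y = c"
        "\<And>y. (c,y) \<in> C \<Longrightarrow> y = d" "\<And>y. (d,y) \<in> C \<Longrightarrow> y = e" "\<And>y. (e,y) \<in> C \<Longrightarrow> y = a"
      using dist by (auto simp: t(2) arcs5_def)
    consider "a' = a" | "a' = b" | "a' = c" | "a' = d" | "a' = e"
      using *(1) by (auto simp: t(2) arcs5_def)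
    then show "(a',b',c',d',e') \<in> set ?R"
      by cases (use * in \<open>auto dest!: succs\<close>)
  qed
  then have "card {t \<in> cycle5_tuples. arcs5 t = C} \<le> card (set ?R)"
    by (intro card_mono) auto
  also have "\<dots> \<le> 5"
    using card_length[of ?R] by simp
  finally show ?thesis .
qed (simp only: card.empty)

lemma card_cycle5_tuples_le: "card cycle5_tuples \<le> 5 * num_dcycles T 5"
proof -
  have "dcycles T 5 \<subseteq> Pow (parcs T)"
    by (auto simp: dcycles_def pre_digraph.cycle_def pre_digraph.awalk_def)
  then have fin: "finite (dcycles T 5)"
    by (rule finite_subset) simp
  have "cycle5_tuples = (\<Union>C\<in>dcycles T 5. {t \<in> cycle5_tuples. arcs5 t = C})"
    using arcs5_dcycle by auto
  then have "card cycle5_tuples \<le> (\<Sum>C\<in>dcycles T 5. card {t \<in> cycle5_tuples. arcs5 t = C})"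
    using card_UN_le[OF fin, of "\<lambda>C. {t \<in> cycle5_tuples. arcs5 t = C}"] by simp
  also have "\<dots> \<le> (\<Sum>C\<in>dcycles T 5. 5)"
    by (intro sum_mono card_arcs5_fibre_le)
  finally show ?thesis
    by (simp add: num_dcycles_def)
qed

text \<open>The factor 160 is 32 from the indicator times 5 starting vertices; \<open>?B\<close> is
  the lower bound for the paths with four arcs.\<close>

lemma num_dcycles_5_ge:
  "signs.n * (signs.n - 1) * (signs.n - 2) * (signs.n - 3) * (signs.n - 4)
      + 5 * ((signs.n - 3) * (signs.n - 4) * (signs.n * (signs.n - 1) - signs.score_sq))
      + 5 * (signs.n * (signs.n - 1) * (signs.n - 3) - (3 * signs.n - 6) * signs.score_sq
        - signs.n * (signs.n - 1) * (signs.n - 2) * (signs.n - 3))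
    \<le> 160 * real (num_dcycles T 5)"
    (is "?A + 5 * ?B \<le> _")
proof -
  have "real (card cycle5_tuples) \<le> 5 * real (num_dcycles T 5)"
    using of_nat_mono[OF card_cycle5_tuples_le, where 'a = real] by simp
  then have "32 * real (card cycle5_tuples) \<le> 160 * real (num_dcycles T 5)"
    by simp
  moreover have "?A + 5 * ?B \<le> 32 * real (card cycle5_tuples)"
    unfolding card_cycle5_tuples signs.sum_5_cycle_indicator
    by (intro add_left_mono mult_left_mono signs.sum_4_path_ge) simp
  ultimately show ?thesis
    by (rule order_trans[rotated])
qed

end

section \<open>Comparison with the binomial form of the bound\<close>

theorem corollary2p3:
  fixes T :: "'a pair_pre_digraph" and n :: nat
  assumes "tournament T"
    and "card (pverts T) = n"
  shows "real (num_dcycles T 5) \<ge>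
      3 / 4 * real (n choose 5)
      - 1 / 2 * real ((n - 2) choose 2)
          * (\<Sum>w\<in>pverts T. (real (out_degree (with_proj T) w) - (real n - 1) / 2)\<^sup>2)
      - 3 / 8 * real (n choose 3)"
proof -
  interpret tournament T by fact
  let ?S = "\<Sum>w\<in>pverts T. (real (out_degree (with_proj T) w) - (real n - 1) / 2)\<^sup>2"
  have S: "signs.score_sq = 4 * ?S"
    unfolding sum_distrib_left
  proof (intro sum.cong refl)
    fix w assume "w \<in> pverts T"
    then have "signs.score w = 2 * (real (out_degree (with_proj T) w) - (real n - 1) / 2)"
      by (simp add: score_eq assms(2) field_simps)
    then show "(signs.score w)\<^sup>2 = 4 * (real (out_degree (with_proj T) w) - (real n - 1) / 2)\<^sup>2"
      by (simp only: power_mult_distrib) simp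
  qed
  have S0: "?S \<ge> 0"
    by (simp add: sum_nonneg)
  show ?thesis
  \<comment> \<open>For \<open>n < 5\<close> the claimed bound is at most 0, as
    \<open>n choose 5\<close> vanishes. The other case relies on
    \<open>x * x - 6 * x + 6 >= 0\<close>, which fails at 2, 3 and 4.\<close>
  proof (cases "n < 5")
    case True
    have "0 \<le> 1 / 2 * real ((n - 2) choose 2) * ?S" "0 \<le> 3 / 8 * real (n choose 3)"
      using S0 by auto
    moreover have "3 / 4 * real (n choose 5) \<le> real (num_dcycles T 5)"
      using True by (simp add: binomial_eq_0)
    ultimately show ?thesis
      by linarith
  next
    case False
    define x where "x = real n"
    have x: "x \<ge> 5"
      using False by (simp add: x_def)
    have c5: "real (n choose 5) = x * (x - 1) * (x - 2) * (x - 3) * (x - 4) / 120"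
      unfolding binomial_gbinomial gbinomial_prod_rev
      by (simp add: x_def numeral_eq_Suc fact_Suc algebra_simps)
    have c3: "real (n choose 3) = x * (x - 1) * (x - 2) / 6"
      unfolding binomial_gbinomial gbinomial_prod_rev
      by (simp add: x_def numeral_eq_Suc fact_Suc algebra_simps)
    have c2: "real ((n - 2) choose 2) = (x - 2) * (x - 3) / 2"
      unfolding binomial_gbinomial gbinomial_prod_rev using False
      by (simp add: x_def numeral_eq_Suc fact_Suc algebra_simps of_nat_diff)
    have main: "160 * real (num_dcycles T 5) \<ge> x * (x - 1) * (x - 2) * (x - 3) * (x - 4)
        + 5 * ((x - 3) * (x - 4) * (x * (x - 1) - 4 * ?S))
        + 5 * (x * (x - 1) * (x - 3) - (3 * x - 6) * (4 * ?S) - x * (x - 1) * (x - 2) * (x - 3))"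
      using num_dcycles_5_ge unfolding S assms(2) x_def .
    have scalar: "x * (x - 1) * (x - 1) \<ge> 0"
      using x by simp
    \<comment> \<open>This product is \<open>x * x - 6 * x + 5\<close>, one less than the quadratic
      wanted.\<close>
    have "(x - 5) * (x - 1) \<ge> 0"
      using x by simp
    then have "x * x - 6 * x + 6 \<ge> 0"
      by (simp add: algebra_simps)
    then have scores: "(x * x - 6 * x + 6) * ?S \<ge> 0"
      using S0 by (rule mult_nonneg_nonneg)
    \<comment> \<open>The bound obtained is 160 times the claimed one plus two surplus terms, whose
      signs are given by \<open>scalar\<close> and \<open>scores\<close>.\<close>
    have split: "x * (x - 1) * (x - 2) * (x - 3) * (x - 4)
        + 5 * ((x - 3) * (x - 4) * (x * (x - 1) - 4 * y))
        + 5 * (x * (x - 1) * (x - 3) - (3 * x - 6) * (4 * y) - x * (x - 1) * (x - 2) * (x - 3))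
      = 160 * (3 / 4 * (x * (x - 1) * (x - 2) * (x - 3) * (x - 4) / 120)
          - 1 / 2 * ((x - 2) * (x - 3) / 2) * y - 3 / 8 * (x * (x - 1) * (x - 2) / 6))
        + 5 * (x * (x - 1) * (x - 1)) + 20 * ((x * x - 6 * x + 6) * y)" for y
      by (simp add: field_simps)
    have "r \<le> c" if "160 * r + 5 * p + 20 * q \<le> 160 * c" "p \<ge> 0" "q \<ge> 0" for r c p q :: real
      using that by linarith
    from this[OF main[unfolded split] scalar scores] show ?thesis
      unfolding c5 c3 c2 .
  qed
qed

end
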